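(* Consider an MDSP instance with $m$ drones and let $\Delta$ be the maximum degree of the interval graph of the delivery intervals. Let $S_1,\dots,S_{m+\Delta}$ be pairwise disjoint subsets of $\mathcal{N}$, each of which is compatible, such that $U=\bigcup_{i=1}^{m+\Delta}S_i$ consists of $\sum_{i}|S_i|$ deliveries of largest density (i.e., $d_u\ge d_v$ for all $u\in U$, $v\in\mathcal{N}\setminus U$), and such that at least $m$ of the sets $S_i$ are critical. Then $\sum_{i=1}^{m+\Delta}\mathcal{P}(S_i)\ge f(m)$.
   Context: An MDSP instance consists of deliveries $\mathcal{N}=\{1,\dots,n\}$ and $m$ drones, each with battery budget $B>0$. Each delivery $j$ has a closed time interval $I_j=[t_j^L,t_j^R]$, a cost $c_j>0$ and a profit $p_j\ge0$; its density is $d_j=p_j/c_j$. Deliveries $j\ne k$ are compatible if $I_j\cap I_k=\emptyset$. A set $S$ is compatible if its elements are pairwise compatible and feasible if also $\mathcal{W}(S)=\sum_{j\in S}c_j\le B$; $\mathcal{P}(S)=\sum_{j\in S}p_j$. $f(m)$ is the maximum of $\sum_{i=1}^m\mathcal{P}(T_i)$ over pairwise disjoint feasible sets $T_1,\dots,T_m$. A set $S=\{k_1,\dots,k_l\}$ listed with $d_{k_1}\ge\dots\ge d_{k_l}$ is critical if $\mathcal{W}(S)>B$ and $\mathcal{W}(S\setminus\{k_l\})\le B$. The interval graph has vertex set $\mathcal{N}$ and an edge between $j\ne k$ iff $I_j\cap I_k\ne\emptyset$; $\Delta$ is its maximum degree. *)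

theory Defs
  imports Complex_Main "HOL-Library.Disjoint_Sets" "HOL-Library.FuncSet"
begin

text \<open>The number of drones is not a field of the record: it is passed as an argument wherever
  it is needed, since the optimum is regarded as a function of it.\<close>

record mdsp =
  num_deliveries :: nat
  t_left :: "nat \<Rightarrow> real"
  t_right :: "nat \<Rightarrow> real"
  cost :: "nat \<Rightarrow> real"
  profit :: "nat \<Rightarrow> real"
  budget :: real

definition deliveries :: "mdsp \<Rightarrow> nat set" where
  "deliveries M = {1..num_deliveries M}"

definition mdsp_instance :: "mdsp \<Rightarrow> bool" where
  "mdsp_instance M \<longleftrightarrow> budget M > 0 \<and>
     (\<forall>j\<in>deliveries M. t_left M j \<le> t_right M j \<and> cost M j > 0 \<and> profit M j \<ge> 0)"

definition interval :: "mdsp \<Rightarrow> nat \<Rightarrow> real set" where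
  "interval M j = {t_left M j..t_right M j}"

definition density :: "mdsp \<Rightarrow> nat \<Rightarrow> real" where
  "density M j = profit M j / cost M j"

definition total_cost :: "mdsp \<Rightarrow> nat set \<Rightarrow> real" where
  "total_cost M S = (\<Sum>j\<in>S. cost M j)"

definition total_profit :: "mdsp \<Rightarrow> nat set \<Rightarrow> real" where
  "total_profit M S = (\<Sum>j\<in>S. profit M j)"

definition compatible :: "mdsp \<Rightarrow> nat set \<Rightarrow> bool" where
  "compatible M S \<longleftrightarrow> pairwise (\<lambda>j k. interval M j \<inter> interval M k = {}) S"

definition feasible :: "mdsp \<Rightarrow> nat set \<Rightarrow> bool" where
  "feasible M S \<longleftrightarrow> S \<subseteq> deliveries M \<and> compatible M S \<and> total_cost M S \<le> budget M"

text \<open>When several elements share the least density, the last element of the listing is not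
  determined by the set; it is enough that one admissible listing works.\<close>

definition critical :: "mdsp \<Rightarrow> nat set \<Rightarrow> bool" where
  "critical M S \<longleftrightarrow>
     (\<exists>ks. ks \<noteq> [] \<and> distinct ks \<and> set ks = S \<and>
        sorted_wrt (\<lambda>j k. density M j \<ge> density M k) ks \<and>
        total_cost M S > budget M \<and> total_cost M (S - {last ks}) \<le> budget M)"

definition schedules :: "mdsp \<Rightarrow> nat \<Rightarrow> (nat \<Rightarrow> nat set) set" where
  "schedules M m = {T. (\<forall>i\<in>{1..m}. feasible M (T i)) \<and> disjoint_family_on T {1..m}}"

definition opt :: "mdsp \<Rightarrow> nat \<Rightarrow> real" where
  "opt M m = Max ((\<lambda>T. \<Sum>i=1..m. total_profit M (T i)) ` schedules M m)"

definition interval_adj :: "mdsp \<Rightarrow> nat \<Rightarrow> nat \<Rightarrow> bool" where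
  "interval_adj M j k \<longleftrightarrow> j \<in> deliveries M \<and> k \<in> deliveries M \<and> j \<noteq> k \<and>
     interval M j \<inter> interval M k \<noteq> {}"

definition interval_degree :: "mdsp \<Rightarrow> nat \<Rightarrow> nat" where
  "interval_degree M j = card {k. interval_adj M j k}"

text \<open>Inserting 0 only matters for the graph without vertices, whose maximum degree is 0 by
  convention.\<close>

definition max_degree :: "mdsp \<Rightarrow> nat" where
  "max_degree M = Max (insert 0 (interval_degree M ` deliveries M))"

text \<open>The maximum defining \<open>opt\<close> ranges over a finite nonempty set, although \<open>schedules\<close> itself is
  infinite because schedules are arbitrary outside of \<open>{1..m}\<close>.\<close>

lemma finite_schedule_values:
  "finite ((\<lambda>T. \<Sum>i=1..m. total_profit M (T i)) ` schedules M m)"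
proof -
  let ?P = "\<lambda>T. \<Sum>i=1..m. total_profit M (T i)"
  let ?F = "PiE {1..m} (\<lambda>_. Pow (deliveries M))"
  have "finite ?F"
    by (intro finite_PiE) (auto simp: deliveries_def)
  moreover have "?P ` schedules M m \<subseteq> ?P ` ?F"
  proof
    fix x assume "x \<in> ?P ` schedules M m"
    then obtain T where T: "T \<in> schedules M m" "x = ?P T" by blast
    have "restrict T {1..m} \<in> ?F"
      using T(1) by (auto simp: schedules_def feasible_def)
    moreover have "x = ?P (restrict T {1..m})"
      using T(2) by simp
    ultimately show "x \<in> ?P ` ?F" by blast
  qed
  ultimately show ?thesis
    by (meson finite_imageI finite_subset)
qed

lemma schedules_nonempty:
  assumes "mdsp_instance M"
  shows "schedules M m \<noteq> {}"
proof -
  have "(\<lambda>_. {}) \<in> schedules M m"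
    using assms
    by (auto simp: schedules_def feasible_def compatible_def total_cost_def
        mdsp_instance_def disjoint_family_on_def)
  then show ?thesis by blast
qed

end

theory Submission
  imports Defs
begin

text \<open>The theorem is a greedy exchange argument. Since \<open>m\<close> of the disjoint sets are critical, \<open>U\<close>
  costs at least \<open>m B\<close>, whereas the union \<open>V\<close> of an optimal schedule costs at most \<open>m B\<close>. Hence
  \<open>V - U\<close> costs no more than \<open>U - V\<close>, and its densities are no larger, so it earns no more.\<close>

text \<open>The common part \<open>U \<inter> V\<close> cancels from both sums, leaving
  \<open>V - U\<close> to be compared with \<open>U - V\<close>. A single density \<open>d\<close>
  separates these two sets, so the cost inequality, scaled by \<open>d\<close>, becomes a profit
  inequality.\<close>

lemma sum_greedy_density_ge:
  fixes c p :: "'a \<Rightarrow> real"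
  assumes fin: "finite U" "finite V"
    and c_pos: "\<And>x. x \<in> U \<union> V \<Longrightarrow> c x > 0"
    and p_nonneg: "\<And>x. x \<in> U \<union> V \<Longrightarrow> p x \<ge> 0"
    and dens: "\<And>u v. u \<in> U \<Longrightarrow> v \<in> V - U \<Longrightarrow> p u / c u \<ge> p v / c v"
    and cost_le: "sum c V \<le> sum c U"
  shows "sum p V \<le> sum p U"
proof -
  have split: "sum f A = sum f (A \<inter> A') + sum f (A - A')" if "finite A"
    for f :: "'a \<Rightarrow> real" and A A'
    using that by (rule sum.Int_Diff)
  have cost_diff: "sum c (V - U) \<le> sum c (U - V)"
    using cost_le split[OF fin(1), of c V] split[OF fin(2), of c U] by (simp add: Int_commute)
  have "sum p (V - U) \<le> sum p (U - V)"
  proof (cases "U - V = {}")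
    case True
    \<comment> \<open>There is no least density to take here. Instead, \<open>V - U\<close> has cost
      at most 0, and positive costs force it to be empty.\<close>
    have "V - U = {}"
    proof (rule ccontr)
      assume "V - U \<noteq> {}"
      then have "sum c (V - U) > 0"
        using fin c_pos by (intro sum_pos) auto
      then show False
        using cost_diff unfolding True by simp
    qed
    then show ?thesis
      using True by simp
  next
    case False
    \<comment> \<open>The separating density: elements of \<open>U - V\<close> have density at least
      \<open>d\<close> by minimality, and those of \<open>V - U\<close> at most \<open>d\<close>
      because the minimum is attained in \<open>U\<close>.\<close>
    define d where "d = Min ((\<lambda>u. p u / c u) ` (U - V))"
    have "d \<in> (\<lambda>u. p u / c u) ` (U - V)"
      unfolding d_def using False fin by (intro Min_in) auto
    then obtain u where u: "u \<in> U - V" "d = p u / c u"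
      by auto
    \<comment> \<open>The sign matters: the cost inequality is multiplied by \<open>d\<close>
      below.\<close>
    have d_nonneg: "d \<ge> 0"
      using u c_pos[of u] p_nonneg[of u] by simp
    have "sum p (V - U) \<le> (\<Sum>v\<in>V - U. d * c v)"
    proof (rule sum_mono)
      fix v assume v: "v \<in> V - U"
      then have "p v / c v \<le> d"
        using dens[of u v] u by auto
      then show "p v \<le> d * c v"
        using c_pos[of v] v by (simp add: pos_divide_le_eq)
    qed
    also have "\<dots> = d * sum c (V - U)"
      by (simp add: sum_distrib_left)
    also have "\<dots> \<le> d * sum c (U - V)"
      using cost_diff d_nonneg by (rule mult_left_mono)
    also have "\<dots> = (\<Sum>x\<in>U - V. d * c x)"
      by (simp add: sum_distrib_left)
    also have "\<dots> \<le> sum p (U - V)"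
    proof (rule sum_mono)
      fix x assume x: "x \<in> U - V"
      then have "d \<le> p x / c x"
        unfolding d_def using fin by (intro Min_le) auto
      then show "d * c x \<le> p x"
        using c_pos[of x] x by (simp add: pos_le_divide_eq)
    qed
    finally show ?thesis .
  qed
  then show ?thesis
    using split[OF fin(1), of p V] split[OF fin(2), of p U] by (simp add: Int_commute)
qed

lemma opt_attained:
  assumes "mdsp_instance M"
  obtains T where "T \<in> schedules M m" "opt M m = (\<Sum>i=1..m. total_profit M (T i))"
proof -
  have "opt M m \<in> (\<lambda>T. \<Sum>i=1..m. total_profit M (T i)) ` schedules M m"
    unfolding opt_def using finite_schedule_values schedules_nonempty[OF assms]
    by (intro Max_in) auto
  then show ?thesis
    using that by auto
qed

lemma sum_UN_disjoint_family:
  fixes f :: "'b \<Rightarrow> 'c::comm_monoid_add"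
  assumes "finite I" "\<And>i. i \<in> I \<Longrightarrow> finite (A i)" "disjoint_family_on A I"
  shows "(\<Sum>i\<in>I. sum f (A i)) = sum f (\<Union>i\<in>I. A i)"
  using assms by (subst sum.UNION_disjoint) (auto simp: disjoint_family_on_def)

theorem theorem4:
  fixes M :: mdsp and m \<Delta> :: nat and S :: "nat \<Rightarrow> nat set" and U :: "nat set"
  assumes "mdsp_instance M"
    and "\<Delta> = max_degree M"
    and "\<And>i. i \<in> {1..m + \<Delta>} \<Longrightarrow> S i \<subseteq> deliveries M"
    and "\<And>i. i \<in> {1..m + \<Delta>} \<Longrightarrow> compatible M (S i)"
    and "disjoint_family_on S {1..m + \<Delta>}"
    and "U = (\<Union>i\<in>{1..m + \<Delta>}. S i)"
    and "\<And>u v. u \<in> U \<Longrightarrow> v \<in> deliveries M - U \<Longrightarrow> density M u \<ge> density M v"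
    and "card {i \<in> {1..m + \<Delta>}. critical M (S i)} \<ge> m"
  shows "(\<Sum>i=1..m + \<Delta>. total_profit M (S i)) \<ge> opt M m"
proof -
  let ?I = "{1..m + \<Delta>}"
  let ?C = "{i \<in> ?I. critical M (S i)}"
  have fin_del: "finite (deliveries M)"
    by (simp add: deliveries_def)
  have pos: "budget M > 0" "\<And>j. j \<in> deliveries M \<Longrightarrow> cost M j > 0"
    "\<And>j. j \<in> deliveries M \<Longrightarrow> profit M j \<ge> 0"
    using assms(1) by (auto simp: mdsp_instance_def)
  obtain T where T: "T \<in> schedules M m" "opt M m = (\<Sum>i=1..m. total_profit M (T i))"
    using opt_attained[OF assms(1)] .
  define V where "V = (\<Union>i\<in>{1..m}. T i)"
  have T_feas: "T i \<subseteq> deliveries M" "total_cost M (T i) \<le> budget M" if "i \<in> {1..m}" for i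
    using T(1) that by (auto simp: schedules_def feasible_def)
  have T_disj: "disjoint_family_on T {1..m}"
    using T(1) by (simp add: schedules_def)
  have sub: "U \<subseteq> deliveries M" "V \<subseteq> deliveries M"
    using assms(3,6) T_feas(1) unfolding V_def by blast+
  \<comment> \<open>Kept general in \<open>f\<close> because it serves both for costs and for
    profits.\<close>
  have sum_U: "(\<Sum>i\<in>?I. sum f (S i)) = sum f U" for f :: "nat \<Rightarrow> real"
    unfolding assms(6) using finite_subset[OF assms(3) fin_del] assms(5)
    by (intro sum_UN_disjoint_family) simp_all
  have sum_V: "(\<Sum>i=1..m. sum f (T i)) = sum f V" for f :: "nat \<Rightarrow> real"
    unfolding V_def using finite_subset[OF T_feas(1) fin_del] T_disj
    by (intro sum_UN_disjoint_family) simp_all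
  have "sum (cost M) V \<le> real m * budget M"
    using sum_bounded_above[of "{1..m}" "\<lambda>i. total_cost M (T i)" "budget M"] T_feas(2)
    by (simp add: sum_V[symmetric] total_cost_def)
  also have "\<dots> \<le> real (card ?C) * budget M"
    using assms(8) pos(1) by (intro mult_right_mono) auto
  \<comment> \<open>Each critical set costs more than the budget, but only the weak inequality
    survives summation, since \<open>?C\<close> may be empty when \<open>m = 0\<close>.\<close>
  also have "\<dots> \<le> (\<Sum>i\<in>?C. total_cost M (S i))"
    by (intro sum_bounded_below) (auto simp: critical_def)
  also have "\<dots> \<le> (\<Sum>i\<in>?I. total_cost M (S i))"
  proof (intro sum_mono2)
    fix i assume "i \<in> ?I - ?C"
    then show "total_cost M (S i) \<ge> 0"
      unfolding total_cost_def using assms(3) pos(2) by (intro sum_nonneg) force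
  qed auto
  also have "\<dots> = sum (cost M) U"
    by (simp only: total_cost_def sum_U)
  finally have "sum (cost M) V \<le> sum (cost M) U" .
  then have "sum (profit M) V \<le> sum (profit M) U"
  proof (rule sum_greedy_density_ge[rotated -1])
    show "finite U" "finite V"
      using sub fin_del by (blast intro: finite_subset)+
    \<comment> \<open>Elements of \<open>V\<close> are deliveries, so those outside \<open>U\<close>
      fall under the assumption that \<open>U\<close> consists of deliveries of largest
      density.\<close>
    show "profit M v / cost M v \<le> profit M u / cost M u" if "u \<in> U" "v \<in> V - U" for u v
      using assms(7)[of u v] that sub by (auto simp: density_def)
  qed (use sub pos(2,3) in blast)+
  then show ?thesis
    by (simp only: T(2) total_profit_def sum_U sum_V)
qed

end
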